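(* Let $(S,\to,\twoheadrightarrow,\hookrightarrow)$ be a two-acyclic factorization system and let $X\subseteq S$ be a closed set. Then $\operatorname{Del}(X,c)\lessdot X$ in the lattice of closed sets for all $c\in\operatorname{Cov}(X)$, and every element covered by $X$ is $\operatorname{Del}(X,c)$ for a unique $c\in\operatorname{Cov}(X)$.
   Context: For a binary relation $\to$ on a set $S$ and $X\subseteq S$, put $X^\perp=\{y\in S: x\not\to y\ \forall x\in X\}$ and ${}^\perp X=\{y\in S: y\not\to x\ \forall x\in X\}$. The closure of $X$ is $\overline X={}^\perp(X^\perp)$; $X$ is closed if $\overline X=X$. The closed sets, ordered by containment, form a complete lattice; $A\lessdot B$ means $B$ covers $A$. For a reflexive relation $\to$ on $S$, $\operatorname{Fact}(\to)=(\twoheadrightarrow,\hookrightarrow)$, where $x\twoheadrightarrow y$ iff for all $z$, $y\to z$ implies $x\to z$, and $x\hookrightarrow y$ iff for all $z$, $z\to x$ implies $z\to y$. For preorders $\twoheadrightarrow,\hookrightarrow$ on $S$, $\operatorname{Mult}(\twoheadrightarrow,\hookrightarrow)$ is the relation relating $x$ to $z$ iff there is $y\in S$ with $x\twoheadrightarrow y\hookrightarrow z$. A factorization system is a tuple $(S,\to,\twoheadrightarrow,\hookrightarrow)$ ($S$ possibly infinite) with $\to$ reflexive, $\operatorname{Fact}(\to)=(\twoheadrightarrow,\hookrightarrow)$ and $\operatorname{Mult}(\twoheadrightarrow,\hookrightarrow)=\to$. It is two-acyclic if $x\twoheadrightarrow y\twoheadrightarrow x$ implies $x=y$, $x\hookrightarrow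 y\hookrightarrow x$ implies $x=y$, and $x\twoheadrightarrow y\hookrightarrow x$ implies $x=y$. For $c\in X$, $\operatorname{Del}(X,c)=X\setminus\{x\in X: x\twoheadrightarrow c\}$. For a closed set $X$, $\operatorname{Cov}(X)$ is the set of elements $c\in X$ such that $\operatorname{Del}(X,c)$ is closed and $\overline{\operatorname{Del}(X,c)\cup\{c\}}=X$. *)

theory Defs
  imports Main
begin

text \<open>
  A binary relation on a set \<open>S\<close> is a set \<open>r \<subseteq> S \<times> S\<close> of pairs, with \<open>(x, y) \<in> r\<close> standing for
  \<open>x \<rightarrow> y\<close>. The carrier \<open>S\<close> is explicit, and may be empty or infinite.
\<close>

definition right_perp :: "'a set \<Rightarrow> 'a rel \<Rightarrow> 'a set \<Rightarrow> 'a set" where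
  "right_perp S r X = {y \<in> S. \<forall>x\<in>X. (x, y) \<notin> r}"

definition left_perp :: "'a set \<Rightarrow> 'a rel \<Rightarrow> 'a set \<Rightarrow> 'a set" where
  "left_perp S r X = {y \<in> S. \<forall>x\<in>X. (y, x) \<notin> r}"

definition rel_closure :: "'a set \<Rightarrow> 'a rel \<Rightarrow> 'a set \<Rightarrow> 'a set" where
  "rel_closure S r X = left_perp S r (right_perp S r X)"

definition rel_closed :: "'a set \<Rightarrow> 'a rel \<Rightarrow> 'a set \<Rightarrow> bool" where
  "rel_closed S r X \<longleftrightarrow> X \<subseteq> S \<and> rel_closure S r X = X"

text \<open>The cover relation \<open>A \<lessdot> B\<close> in a family of sets \<open>\<F>\<close> ordered by containment.\<close>

definition covered_by_in :: "'a set set \<Rightarrow> 'a set \<Rightarrow> 'a set \<Rightarrow> bool" where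
  "covered_by_in \<F> A B \<longleftrightarrow>
     A \<in> \<F> \<and> B \<in> \<F> \<and> A \<subset> B \<and> \<not> (\<exists>C\<in>\<F>. A \<subset> C \<and> C \<subset> B)"

definition Fact :: "'a set \<Rightarrow> 'a rel \<Rightarrow> 'a rel \<times> 'a rel" where
  "Fact S r =
     ({(x, y) \<in> S \<times> S. \<forall>z\<in>S. (y, z) \<in> r \<longrightarrow> (x, z) \<in> r},
      {(x, y) \<in> S \<times> S. \<forall>z\<in>S. (z, x) \<in> r \<longrightarrow> (z, y) \<in> r})"

definition Mult :: "'a set \<Rightarrow> 'a rel \<Rightarrow> 'a rel \<Rightarrow> 'a rel" where
  "Mult S p q = {(x, z) \<in> S \<times> S. \<exists>y\<in>S. (x, y) \<in> p \<and> (y, z) \<in> q}"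

text \<open>
  In the following, \<open>r\<close>, \<open>p\<close> and \<open>q\<close> are the relations \<open>\<rightarrow>\<close>, \<open>\<twoheadrightarrow>\<close> and \<open>\<hookrightarrow>\<close> respectively.
  The condition \<open>r \<subseteq> S \<times> S\<close> is stated separately because \<^const>\<open>refl_on\<close> does not include it;
  for \<open>p\<close> and \<open>q\<close> the corresponding inclusions, and the preorder laws, follow from \<open>Fact S r = (p, q)\<close>.
\<close>

definition factorization_system :: "'a set \<Rightarrow> 'a rel \<Rightarrow> 'a rel \<Rightarrow> 'a rel \<Rightarrow> bool" where
  "factorization_system S r p q \<longleftrightarrow>
     r \<subseteq> S \<times> S \<and> refl_on S r \<and> Fact S r = (p, q) \<and> Mult S p q = r"

definition two_acyclic :: "'a set \<Rightarrow> 'a rel \<Rightarrow> 'a rel \<Rightarrow> bool" where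
  "two_acyclic S p q \<longleftrightarrow>
     (\<forall>x\<in>S. \<forall>y\<in>S. (x, y) \<in> p \<and> (y, x) \<in> p \<longrightarrow> x = y) \<and>
     (\<forall>x\<in>S. \<forall>y\<in>S. (x, y) \<in> q \<and> (y, x) \<in> q \<longrightarrow> x = y) \<and>
     (\<forall>x\<in>S. \<forall>y\<in>S. (x, y) \<in> p \<and> (y, x) \<in> q \<longrightarrow> x = y)"

definition Del :: "'a rel \<Rightarrow> 'a set \<Rightarrow> 'a \<Rightarrow> 'a set" where
  "Del p X c = X - {x \<in> X. (x, c) \<in> p}"

definition Cov :: "'a set \<Rightarrow> 'a rel \<Rightarrow> 'a rel \<Rightarrow> 'a set \<Rightarrow> 'a set" where
  "Cov S r p X =
     {c \<in> X. rel_closed S r (Del p X c) \<and> rel_closure S r (Del p X c \<union> {c}) = X}"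

end

theory Submission
  imports Defs
begin

text \<open>
  Suppose that \<open>A\<close> is covered by \<open>X\<close>. Cutting \<open>X\<close> by \<open>\<^sup>\<bottom>{y}\<close> shows that every element of \<open>X - A\<close>
  is related by \<open>\<rightarrow>\<close> to every \<open>y\<close> in \<open>A\<^sup>\<bottom> - X\<^sup>\<bottom>\<close>. Hence \<open>\<rightarrow>\<close> is total on \<open>D = (X - A) \<inter> A\<^sup>\<bottom>\<close>, and
  factoring \<open>x \<rightarrow> y\<close> with \<open>x\<close> in \<open>X - A\<close> and \<open>y\<close> in \<open>A\<^sup>\<bottom>\<close> always passes through \<open>D\<close>. If
  \<open>d \<twoheadrightarrow> f\<close> in \<open>D\<close>, then factoring \<open>f \<rightarrow> d\<close> as \<open>f \<twoheadrightarrow> g \<hookrightarrow> d\<close> gives \<open>d \<twoheadrightarrow> g \<hookrightarrow> d\<close>, so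
  \<open>d = g = f\<close> by two-acyclicity. So on \<open>D\<close> every two elements are related by \<open>\<hookrightarrow>\<close> both ways, and \<open>D\<close>
  is a single point \<open>c\<close>; factoring through it shows \<open>X - A = {x \<in> X. x \<twoheadrightarrow> c}\<close>.
\<close>

lemma rel_closed_rel_closure: "rel_closed S r (rel_closure S r X)"
  by (auto simp: rel_closed_def rel_closure_def left_perp_def right_perp_def)

lemma rel_closure_extensive: "X \<subseteq> S \<Longrightarrow> X \<subseteq> rel_closure S r X"
  by (auto simp: rel_closure_def left_perp_def right_perp_def)

lemma rel_closure_minimal: "rel_closed S r C \<Longrightarrow> X \<subseteq> C \<Longrightarrow> rel_closure S r X \<subseteq> C"
  unfolding rel_closed_def rel_closure_def left_perp_def right_perp_def by fast

lemma rel_closed_separation: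
  assumes "rel_closed S r A" "x \<in> S" "x \<notin> A"
  obtains y where "y \<in> right_perp S r A" "(x, y) \<in> r"
  using assms unfolding rel_closed_def rel_closure_def left_perp_def by blast

text \<open>For closed \<open>X\<close> this intersection is the \<open>left_perp\<close> of
  \<open>right_perp S r X\<close> together with \<open>y\<close>, and every set of the form
  \<open>left_perp\<close> is closed.\<close>

lemma rel_closed_Int_left_perp:
  assumes "rel_closed S r X" "y \<in> S"
  shows "rel_closed S r (X \<inter> left_perp S r {y})"
  using assms unfolding rel_closed_def rel_closure_def left_perp_def right_perp_def by fast

lemma covered_by_in_related:
  assumes cov: "covered_by_in {A. rel_closed S r A} A X"
    and x: "x \<in> X - A" and y: "y \<in> right_perp S r A - right_perp S r X"
  shows "(x, y) \<in> r"
proof (rule ccontr)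
  assume nr: "(x, y) \<notin> r"
  let ?C = "X \<inter> left_perp S r {y}"
  have AX: "A \<subset> X" "X \<subseteq> S" and cX: "rel_closed S r X"
    using cov by (auto simp: covered_by_in_def rel_closed_def)
  have yS: "y \<in> S"
    using y by (auto simp: right_perp_def)
  \<comment> \<open>The cut keeps \<open>A\<close> because \<open>y\<close> lies in its right perp,
    and it keeps \<open>x\<close> outside \<open>A\<close> because of \<open>nr\<close>.\<close>
  have "A \<subset> ?C"
    using AX x y nr by (auto simp: left_perp_def right_perp_def)
  moreover have "?C \<subset> X"
    using y yS by (auto simp: left_perp_def right_perp_def)
  ultimately show False
    using cov rel_closed_Int_left_perp[OF cX yS] unfolding covered_by_in_def by blast
qed

lemma factorization_system_p_iff:
  assumes "factorization_system S r p q"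
  shows "(x, y) \<in> p \<longleftrightarrow> x \<in> S \<and> y \<in> S \<and> (\<forall>z\<in>S. (y, z) \<in> r \<longrightarrow> (x, z) \<in> r)"
  using assms by (auto simp: factorization_system_def Fact_def)

lemma factorization_system_q_iff:
  assumes "factorization_system S r p q"
  shows "(x, y) \<in> q \<longleftrightarrow> x \<in> S \<and> y \<in> S \<and> (\<forall>z\<in>S. (z, x) \<in> r \<longrightarrow> (z, y) \<in> r)"
  using assms by (auto simp: factorization_system_def Fact_def)

lemma factorization_system_refl:
  "factorization_system S r p q \<Longrightarrow> x \<in> S \<Longrightarrow> (x, x) \<in> r"
  by (auto simp: factorization_system_def refl_on_def)

lemma factorization_system_factor:
  assumes "factorization_system S r p q" "(x, z) \<in> r"
  obtains y where "(x, y) \<in> p" "(y, z) \<in> q"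
  using assms unfolding factorization_system_def Mult_def by blast

text \<open>If \<open>y\<close> were outside \<open>X\<close>, some \<open>z\<close> in
  \<open>right_perp S r X\<close> would satisfy \<open>(y, z) \<in> r\<close>; then
  \<open>(x, y) \<in> p\<close> gives \<open>(x, z) \<in> r\<close>, which is impossible for
  \<open>x\<close> in \<open>X\<close>.\<close>

lemma rel_closed_p_closed:
  assumes "factorization_system S r p q" "rel_closed S r X" "x \<in> X" "(x, y) \<in> p"
  shows "y \<in> X"
  using assms(2-) unfolding factorization_system_p_iff[OF assms(1)]
    rel_closed_def rel_closure_def left_perp_def right_perp_def by fast

text \<open>Since \<open>(c, y) \<in> q\<close>, whatever is related to \<open>c\<close> is related
  to \<open>y\<close>. No element of \<open>A\<close> is related to \<open>y\<close>, so none is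
  related to \<open>c\<close>; and \<open>c\<close> itself is not in \<open>A\<close>, by
  reflexivity.\<close>

lemma factor_through_right_perp:
  assumes fs: "factorization_system S r p q" and cX: "rel_closed S r X"
    and x: "x \<in> X" and y: "y \<in> right_perp S r A" and xy: "(x, y) \<in> r"
  obtains c where "(x, c) \<in> p" "(c, y) \<in> q" "c \<in> X - A" "c \<in> right_perp S r A"
proof -
  obtain c where c: "(x, c) \<in> p" "(c, y) \<in> q"
    using factorization_system_factor[OF fs xy] .
  have cS: "c \<in> S" and up: "\<And>z. (z, c) \<in> r \<Longrightarrow> (z, y) \<in> r"
    using c(2) fs unfolding factorization_system_q_iff[OF fs]
    by (auto simp: factorization_system_def)
  have "c \<in> X"
    using rel_closed_p_closed[OF fs cX x c(1)] .
  moreover have "c \<notin> A" "c \<in> right_perp S r A"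
    using up[OF factorization_system_refl[OF fs cS]] y cS up by (auto simp: right_perp_def)
  ultimately show thesis
    using c that by blast
qed

lemma covered_by_in_unique_separator:
  assumes fs: "factorization_system S r p q" and ac: "two_acyclic S p q"
    and cov: "covered_by_in {A. rel_closed S r A} A X"
    and d: "d \<in> (X - A) \<inter> right_perp S r A" and e: "e \<in> (X - A) \<inter> right_perp S r A"
  shows "d = e"
proof -
  define D where "D = (X - A) \<inter> right_perp S r A"
  have cX: "rel_closed S r X"
    using cov by (auto simp: covered_by_in_def)
  have DS: "D \<subseteq> S"
    by (auto simp: D_def right_perp_def)
  have rel: "(a, b) \<in> r" if "a \<in> D" "b \<in> D" for a b
  proof -
    \<comment> \<open>Here \<open>b\<close> is in \<open>X\<close> and is related to itself.\<close>
    have "b \<notin> right_perp S r X"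
      using that(2) DS factorization_system_refl[OF fs, of b] by (auto simp: D_def right_perp_def)
    then show ?thesis
      using covered_by_in_related[OF cov] that by (auto simp: D_def)
  qed
  have factor: "\<exists>f\<in>D. (a, f) \<in> p \<and> (f, b) \<in> q" if "a \<in> D" "b \<in> D" for a b
    using factor_through_right_perp[OF fs cX _ _ rel[OF that], of A] that
    unfolding D_def by blast
  have p_eq: "a = f" if af: "a \<in> D" "f \<in> D" "(a, f) \<in> p" for a f
  proof -
    obtain g where g: "g \<in> D" "(f, g) \<in> p" "(g, a) \<in> q"
      using factor af by blast
    have "(a, g) \<in> p"
      using af(3) g(2) by (simp add: factorization_system_p_iff[OF fs])
    then have "g = a"
      using g ac af(1) DS unfolding two_acyclic_def by blast
    then show "a = f"
      using g(2) af ac DS unfolding two_acyclic_def by blast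
  qed
  \<comment> \<open>The middle point of the factorization equals \<open>a\<close> by
    \<open>p_eq\<close>, so its \<open>q\<close> half already joins \<open>a\<close> to
    \<open>b\<close>.\<close>
  have "(a, b) \<in> q" if "a \<in> D" "b \<in> D" for a b
    using factor[OF that] p_eq that(1) by blast
  then have "(d, e) \<in> q" "(e, d) \<in> q"
    using d e by (auto simp: D_def)
  then show ?thesis
    using ac d e DS unfolding two_acyclic_def D_def by blast
qed

text \<open>A closed set strictly above \<open>Del p X c\<close> and inside \<open>X\<close>
  contains some \<open>x\<close> with \<open>(x, c) \<in> p\<close>, hence contains
  \<open>c\<close>, and \<open>Del p X c\<close> with \<open>c\<close> generates
  \<open>X\<close>.\<close>

lemma covered_by_in_Del:
  assumes fs: "factorization_system S r p q" and c: "c \<in> Cov S r p X" and cX: "rel_closed S r X"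
  shows "covered_by_in {A. rel_closed S r A} (Del p X c) X"
proof -
  have cl: "rel_closed S r (Del p X c)" and gen: "rel_closure S r (Del p X c \<union> {c}) = X"
    and cinX: "c \<in> X"
    using c by (auto simp: Cov_def)
  have "(c, c) \<in> p"
    using cinX cX by (auto simp: factorization_system_p_iff[OF fs] rel_closed_def)
  then have "Del p X c \<subset> X"
    using cinX by (auto simp: Del_def)
  moreover have "\<not> C \<subset> X" if C: "rel_closed S r C" "Del p X c \<subset> C" for C
  proof
    assume CX: "C \<subset> X"
    then obtain x where x: "x \<in> C" "(x, c) \<in> p"
      using C(2) by (auto simp: Del_def)
    have "c \<in> C"
      using rel_closed_p_closed[OF fs C(1) x] .
    then have "X \<subseteq> C"
      using rel_closure_minimal[OF C(1), of "Del p X c \<union> {c}"] C(2) gen by auto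
    then show False
      using CX by auto
  qed
  ultimately show ?thesis
    using cl cX unfolding covered_by_in_def by blast
qed

lemma covered_by_in_imp_Del:
  assumes fs: "factorization_system S r p q" and ac: "two_acyclic S p q"
    and cov: "covered_by_in {A. rel_closed S r A} A X"
  obtains c where "c \<in> Cov S r p X" "A = Del p X c"
proof -
  have cX: "rel_closed S r X" and cA: "rel_closed S r A" and AX: "A \<subset> X" and XS: "X \<subseteq> S"
    using cov by (auto simp: covered_by_in_def rel_closed_def)
  have factor: "\<exists>c. (x, c) \<in> p \<and> c \<in> X - A \<and> c \<in> right_perp S r A" if x: "x \<in> X - A" for x
  proof -
    have "x \<in> S" "x \<notin> A"
      using x XS by auto
    then obtain y where y: "y \<in> right_perp S r A" "(x, y) \<in> r"
      using rel_closed_separation[OF cA] by blast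
    show ?thesis
      using factor_through_right_perp[OF fs cX _ y] x by blast
  qed
  obtain c where c: "c \<in> X - A" "c \<in> right_perp S r A"
    using AX factor by blast
  \<comment> \<open>The point through which \<open>x\<close> factors depends on \<open>x\<close> a
    priori; uniqueness of the separator identifies it with \<open>c\<close>.\<close>
  have "(x, c) \<in> p" if "x \<in> X - A" for x
    using factor[OF that] covered_by_in_unique_separator[OF fs ac cov] c by blast
  moreover have "(x, c) \<notin> p" if "x \<in> A" for x
    using rel_closed_p_closed[OF fs cA that] c by blast
  ultimately have A: "A = Del p X c"
    using AX by (auto simp: Del_def)
  have sub: "A \<union> {c} \<subseteq> rel_closure S r (A \<union> {c})"
    using rel_closure_extensive[of "A \<union> {c}" S r] AX XS c by auto
  have "rel_closure S r (A \<union> {c}) \<subseteq> X"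
    using rel_closure_minimal[OF cX] AX c by auto
  \<comment> \<open>The closure gains \<open>c\<close>, so the cover relation leaves only
    \<open>X\<close> for it.\<close>
  moreover have "A \<subset> rel_closure S r (A \<union> {c})"
    using sub c by auto
  ultimately have "rel_closure S r (A \<union> {c}) = X"
    using cov rel_closed_rel_closure[of S r "A \<union> {c}"] unfolding covered_by_in_def by blast
  then have "c \<in> Cov S r p X"
    using c cA A by (auto simp: Cov_def)
  then show thesis
    using A that by blast
qed

text \<open>By reflexivity of \<open>p\<close>, each of \<open>c\<close> and \<open>d\<close> is
  removed from its own \<open>Del\<close>, hence also from the other; antisymmetry of
  \<open>p\<close> finishes.\<close>

lemma Del_inj:
  assumes fs: "factorization_system S r p q" and ac: "two_acyclic S p q" and XS: "X \<subseteq> S"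
    and c: "c \<in> X" and d: "d \<in> X" and eq: "Del p X c = Del p X d"
  shows "c = d"
proof -
  have "(c, c) \<in> p" "(d, d) \<in> p"
    using c d XS by (auto simp: factorization_system_p_iff[OF fs])
  then have "(c, d) \<in> p" "(d, c) \<in> p"
    using c d eq unfolding Del_def by blast+
  then show ?thesis
    using ac c d XS unfolding two_acyclic_def by blast
qed

theorem theorem5p1:
  fixes S :: "'a set" and r p q :: "'a rel" and X :: "'a set"
  assumes "factorization_system S r p q"
    and "two_acyclic S p q"
    and "rel_closed S r X"
  shows "(\<forall>c\<in>Cov S r p X. covered_by_in {A. rel_closed S r A} (Del p X c) X) \<and>
         (\<forall>A. covered_by_in {A. rel_closed S r A} A X \<longrightarrow>
              (\<exists>!c. c \<in> Cov S r p X \<and> A = Del p X c))"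
proof (intro conjI ballI allI impI)
  fix c assume "c \<in> Cov S r p X"
  then show "covered_by_in {A. rel_closed S r A} (Del p X c) X"
    by (rule covered_by_in_Del[OF assms(1) _ assms(3)])
next
  fix A assume cov: "covered_by_in {A. rel_closed S r A} A X"
  obtain c where c: "c \<in> Cov S r p X" "A = Del p X c"
    using covered_by_in_imp_Del[OF assms(1,2) cov] .
  moreover have "d = c" if "d \<in> Cov S r p X" "A = Del p X d" for d
  proof (rule Del_inj[OF assms(1,2)])
    show "X \<subseteq> S"
      using assms(3) by (simp add: rel_closed_def)
    show "d \<in> X" "c \<in> X"
      using that(1) c(1) by (simp_all add: Cov_def)
    show "Del p X d = Del p X c"
      by (rule trans[OF that(2)[symmetric] c(2)])
  qed
  ultimately show "\<exists>!c. c \<in> Cov S r p X \<and> A = Del p X c"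
    by blast
qed

end
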